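(* The space of real rational curves of degree $6$ in the sphere $S^3$ is connected.
   Context: $S^3$ denotes the real quadric $x_1^2+x_2^2+x_3^2+x_4^2=x_0^2$ in $\mathbb{RP}^4$. A real rational curve of degree $6$ in $S^3$ (possibly singular) is given by a parametrization $[p_0:p_1:p_2:p_3:p_4]:\mathbb{RP}^1\to\mathbb{RP}^4$, where $p_0,\dots,p_4$ are real homogeneous polynomials of degree $6$ in two variables without common (complex) root and $p_1^2+p_2^2+p_3^2+p_4^2=p_0^2$. The space of such curves is the space of these parametrizations, topologized as a subspace of the projective space $\mathbb{RP}^{34}$ of coefficients. *)

theory Defs
  imports
    "HOL-Analysis.Analysis"
    "HOL-Computational_Algebra.Polynomial"
begin

text \<open>
  The projective space of a real vector space: its points are the lines through the origin, and
  it carries the quotient topology of the punctured vector space. As the punctured space is open,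
  the openness of a preimage can be tested in the whole space.
\<close>

definition proj_point :: "'a::real_normed_vector \<Rightarrow> 'a set" where
  "proj_point v = span {v}"

definition projective_space :: "'a::real_normed_vector set topology" where
  "projective_space =
    topology (\<lambda>U. U \<subseteq> proj_point ` (- {0}) \<and> open {v. v \<noteq> 0 \<and> proj_point v \<in> U})"

lemma openin_projective_space:
  "openin projective_space U \<longleftrightarrow>
    U \<subseteq> proj_point ` (- {0 :: 'a::real_normed_vector}) \<and> open {v. v \<noteq> 0 \<and> proj_point v \<in> U}"
proof -
  have "istopology (\<lambda>U. U \<subseteq> proj_point ` (- {0::'a}) \<and> open {v. v \<noteq> 0 \<and> proj_point v \<in> U})"
    unfolding istopology_def
  proof (intro conjI allI impI)
    fix S T :: "'a set set"
    assume S: "S \<subseteq> proj_point ` (- {0}) \<and> open {v. v \<noteq> 0 \<and> proj_point v \<in> S}"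
      and T: "T \<subseteq> proj_point ` (- {0}) \<and> open {v. v \<noteq> 0 \<and> proj_point v \<in> T}"
    show "S \<inter> T \<subseteq> proj_point ` (- {0})"
      using S by blast
    have "{v. v \<noteq> 0 \<and> proj_point v \<in> S \<inter> T} =
        {v. v \<noteq> 0 \<and> proj_point v \<in> S} \<inter> {v. v \<noteq> 0 \<and> proj_point v \<in> T}"
      by blast
    with S T show "open {v. v \<noteq> 0 \<and> proj_point v \<in> S \<inter> T}"
      by (simp add: open_Int)
  next
    fix \<K> :: "'a set set set"
    assume K: "\<forall>K\<in>\<K>. K \<subseteq> proj_point ` (- {0}) \<and> open {v. v \<noteq> 0 \<and> proj_point v \<in> K}"
    show "\<Union>\<K> \<subseteq> proj_point ` (- {0})"
      using K by blast
    have "{v. v \<noteq> 0 \<and> proj_point v \<in> \<Union>\<K>} = (\<Union>K\<in>\<K>. {v. v \<noteq> 0 \<and> proj_point v \<in> K})"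
      by blast
    with K show "open {v. v \<noteq> 0 \<and> proj_point v \<in> \<Union>\<K>}"
      by (simp add: open_UN)
  qed
  then show ?thesis
    by (simp add: projective_space_def)
qed

lemma topspace_projective_space:
  "topspace projective_space = proj_point ` (- {0 :: 'a::real_normed_vector})"
proof
  show "topspace projective_space \<subseteq> proj_point ` (- {0 :: 'a})"
    using openin_projective_space[of "topspace (projective_space :: 'a set topology)"] by simp
  have "{v. v \<noteq> 0 \<and> proj_point v \<in> proj_point ` (- {0 :: 'a})} = - {0}"
    by auto
  then have "openin projective_space (proj_point ` (- {0 :: 'a}))"
    by (simp add: openin_projective_space open_Compl)
  then show "proj_point ` (- {0 :: 'a}) \<subseteq> topspace projective_space"
    by (rule openin_subset)
qed

lemma quotient_map_proj_point:
  "quotient_map (top_of_set (- {0 :: 'a::real_normed_vector})) projective_space proj_point"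
proof -
  have "{x. x \<in> - {0} \<and> proj_point x \<in> U} = {v. v \<noteq> 0 \<and> proj_point v \<in> U}"
    for U :: "'a set set"
    by simp
  then show ?thesis
    by (simp add: quotient_map_def topspace_projective_space openin_projective_space
        openin_open_eq open_Compl subset_iff)
qed


text \<open>
  A vector \<open>a\<close> of 7 coefficients stands for the binary sextic form
  \<open>a\<^sub>0 t\<^sup>6 + a\<^sub>1 s t\<^sup>5 + \<dots> + a\<^sub>6 s\<^sup>6\<close>. Polynomials in \<open>s\<close> and \<open>t\<close> are polynomials in \<open>t\<close> (outer
  variable) over the polynomials in \<open>s\<close> (inner variable).
\<close>

definition sextic_form :: "real ^ 7 \<Rightarrow> real poly poly" where
  "sextic_form a = (\<Sum>k\<le>6. monom (monom (a $ of_nat k) k) (6 - k))"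

definition eval_complex :: "real poly poly \<Rightarrow> complex \<Rightarrow> complex \<Rightarrow> complex" where
  "eval_complex F s t = poly (poly (map_poly (map_poly complex_of_real) F) [:t:]) s"

lemma eval_complex_sextic_form:
  "eval_complex (sextic_form a) s t = (\<Sum>k\<le>6. of_real (a $ of_nat k) * s ^ k * t ^ (6 - k))"
proof -
  have add: "map_poly complex_of_real (p + q) =
      map_poly complex_of_real p + map_poly complex_of_real q" for p q
    by (rule poly_eqI) (simp add: coeff_map_poly)
  have "map_poly (map_poly complex_of_real) (\<Sum>k\<in>A. monom (monom (a $ of_nat k) k) (6 - k)) =
      (\<Sum>k\<in>A. monom (monom (complex_of_real (a $ of_nat k)) k) (6 - k))" if "finite A" for A
    using that
  proof (induction A)
    case empty
    show ?case by simp
  next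
    case (insert k A)
    have "map_poly (map_poly complex_of_real) (P + Q) =
        map_poly (map_poly complex_of_real) P + map_poly (map_poly complex_of_real) Q" for P Q
      by (rule poly_eqI) (simp add: coeff_map_poly add)
    then show ?case
      using insert by (simp add: map_poly_monom)
  qed
  then show ?thesis
    by (simp add: eval_complex_def sextic_form_def poly_sum poly_monom poly_const_pow mult_ac)
qed


text \<open>
  The tuple \<open>(p\<^sub>0, \<dots>, p\<^sub>4)\<close> of sextic forms is encoded by its coefficients \<open>c\<close>, a vector of the
  35-dimensional space \<^typ>\<open>real ^ 7 ^ 5\<close>; the indices of type \<^typ>\<open>5\<close> are 0, ..., 4.
\<close>

definition no_common_root :: "real ^ 7 ^ 5 \<Rightarrow> bool" where
  "no_common_root c \<longleftrightarrow>
    \<not> (\<exists>s t. (s, t) \<noteq> (0, 0) \<and> (\<forall>i. eval_complex (sextic_form (c $ i)) s t = 0))"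

definition on_S3 :: "real ^ 7 ^ 5 \<Rightarrow> bool" where
  "on_S3 c \<longleftrightarrow>
    (sextic_form (c $ 1))\<^sup>2 + (sextic_form (c $ 2))\<^sup>2 + (sextic_form (c $ 3))\<^sup>2 +
      (sextic_form (c $ 4))\<^sup>2 = (sextic_form (c $ 0))\<^sup>2"

text \<open>
  The rational curves of degree 6 in the 3-sphere, possibly singular, as points of
  \<open>\<real>P\<^sup>3\<^sup>4\<close>. Both conditions are invariant under scaling, and the absence of a common root
  excludes \<open>c = 0\<close>. Parametrizations are not identified up to changes of the parameter.
\<close>

definition sextic_curves_S3 :: "(real ^ 7 ^ 5) set set" where
  "sextic_curves_S3 = {proj_point c | c. no_common_root c \<and> on_S3 c}"

lemma sextic_curves_S3_subset: "sextic_curves_S3 \<subseteq> topspace projective_space"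
  by (auto simp: sextic_curves_S3_def topspace_projective_space no_common_root_def
      eval_complex_sextic_form intro!: imageI)

end

theory Submission
  imports
    Defs
    "HOL-Computational_Algebra.Fundamental_Theorem_Algebra"
begin

text \<open>
  Read \<open>p\<^sub>1, \<dots>, p\<^sub>4\<close> as the components of a quaternionic polynomial \<open>Q\<close> in one variable \<open>t\<close>; the
  curve lies on the sphere iff \<open>N(Q) = p\<^sub>0\<^sup>2\<close>. As \<open>p\<^sub>0\<close> has no real root, up to sign it is
  \<open>l M\<^sub>1 M\<^sub>2 M\<^sub>3\<close> with \<open>l > 0\<close> and \<open>M\<^sub>i = (t - a\<^sub>i)\<^sup>2 + b\<^sub>i\<^sup>2\<close>, \<open>a\<^sub>1 \<le> a\<^sub>2 \<le> a\<^sub>3\<close>. Splitting off left linear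
  factors one at a time writes \<open>Q\<close> as the product of the pairs
  \<open>(t - a\<^sub>i - b\<^sub>i u\<^sub>i) (t - a\<^sub>i - b\<^sub>i v\<^sub>i)\<close>, with imaginary unit quaternions \<open>u\<^sub>i \<noteq> - v\<^sub>i\<close>, and a constant of
  norm \<open>l\<close>. Conversely, if \<open>a\<^sub>1 < a\<^sub>2 < a\<^sub>3\<close>, such a product never has a common root with \<open>p\<^sub>0\<close>. The
  parameters with \<open>a\<^sub>1 < a\<^sub>2 < a\<^sub>3\<close> form a connected set that is dense in the set of all parameters, so
  every set in between is connected, in particular the one that parametrizes the curves.
\<close>

section \<open>Quaternions over a commutative ring\<close>

text \<open>The same algebra serves real polynomials and, after evaluation at a complex point,
  complex coefficients. Complex quaternions have zero divisors, so cancellation goes through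
  \<open>qnorm\<close>.\<close>

datatype 'a quat = Quat (qRe: 'a) (qI: 'a) (qJ: 'a) (qK: 'a)

instantiation quat :: (comm_ring_1) ring_1
begin

definition "0 = Quat 0 0 0 0"
definition "1 = Quat 1 0 0 0"
definition "p + q = Quat (qRe p + qRe q) (qI p + qI q) (qJ p + qJ q) (qK p + qK q)"
definition "p - q = Quat (qRe p - qRe q) (qI p - qI q) (qJ p - qJ q) (qK p - qK q)"
definition "- q = Quat (- qRe q) (- qI q) (- qJ q) (- qK q)"
definition "p * q = Quat
  (qRe p * qRe q - qI p * qI q - qJ p * qJ q - qK p * qK q)
  (qRe p * qI q + qI p * qRe q + qJ p * qK q - qK p * qJ q)
  (qRe p * qJ q - qI p * qK q + qJ p * qRe q + qK p * qI q)
  (qRe p * qK q + qI p * qJ q - qJ p * qI q + qK p * qRe q)"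

lemmas quat_defs = zero_quat_def one_quat_def plus_quat_def minus_quat_def uminus_quat_def
  times_quat_def

instance
  by standard (simp_all add: quat_defs quat.expand algebra_simps)

end

definition scalar :: "'a::comm_ring_1 \<Rightarrow> 'a quat" where
  "scalar r = Quat r 0 0 0"

definition qnorm :: "'a::comm_ring_1 quat \<Rightarrow> 'a" where
  "qnorm q = (qRe q)\<^sup>2 + (qI q)\<^sup>2 + (qJ q)\<^sup>2 + (qK q)\<^sup>2"

definition qcnj :: "'a::comm_ring_1 quat \<Rightarrow> 'a quat" where
  "qcnj q = Quat (qRe q) (- qI q) (- qJ q) (- qK q)"

lemma qnorm_mult: "qnorm (p * q) = qnorm p * qnorm q"
  by (simp add: qnorm_def times_quat_def power2_eq_square algebra_simps)

lemma qcnj_mult: "qcnj q * q = scalar (qnorm q)"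
  by (simp add: qcnj_def qnorm_def scalar_def times_quat_def power2_eq_square algebra_simps)

lemma mult_qcnj: "q * qcnj q = scalar (qnorm q)"
  by (simp add: qcnj_def qnorm_def scalar_def times_quat_def power2_eq_square algebra_simps)

lemma scalar_mult_left: "scalar r * q = Quat (r * qRe q) (r * qI q) (r * qJ q) (r * qK q)"
  by (simp add: scalar_def times_quat_def)

lemma scalar_commute: "q * scalar r = scalar r * q"
  by (simp add: scalar_def times_quat_def mult.commute)

lemma scalar_mult_cancel:
  fixes p q :: "'a::idom quat"
  assumes "scalar r * p = scalar r * q" "r \<noteq> 0"
  shows "p = q"
  using assms by (simp add: scalar_mult_left quat.expand)

lemma scalar_mult_eq_0:
  fixes q :: "'a::idom quat"
  assumes "scalar r * q = 0" "r \<noteq> 0"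
  shows "q = 0"
  using assms by (simp add: scalar_mult_left quat.expand zero_quat_def)

text \<open>Multiplication by the conjugate turns \<open>p\<close> into the scalar
  \<open>qnorm p\<close>, which cancels in a domain.\<close>

lemma qmult_eq_0_left:
  fixes p q :: "'a::idom quat"
  assumes "p * q = 0" "qnorm p \<noteq> 0"
  shows "q = 0"
proof -
  have "scalar (qnorm p) * q = qcnj p * (p * q)"
    by (simp add: qcnj_mult flip: mult.assoc)
  then show ?thesis
    using assms by (simp add: scalar_mult_eq_0)
qed

lemma qmult_eq_0_right:
  fixes p q :: "'a::idom quat"
  assumes "p * q = 0" "qnorm q \<noteq> 0"
  shows "p = 0"
proof -
  have "scalar (qnorm q) * p = p * q * qcnj q"
    by (simp add: mult_qcnj mult.assoc scalar_commute)
  then show ?thesis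
    using assms by (simp add: scalar_mult_eq_0)
qed


section \<open>Quaternionic polynomials with real coefficients\<close>

definition ceval :: "complex \<Rightarrow> real poly \<Rightarrow> complex" where
  "ceval z p = poly (map_poly of_real p) z"

lemma map_poly_of_real_add:
  "map_poly (of_real :: real \<Rightarrow> complex) (p + q) = map_poly of_real p + map_poly of_real q"
  by (rule poly_eqI) (simp add: coeff_map_poly)

lemma map_poly_of_real_mult:
  "map_poly (of_real :: real \<Rightarrow> complex) (p * q) = map_poly of_real p * map_poly of_real q"
  by (rule poly_eqI) (simp add: coeff_map_poly coeff_mult)

lemma ceval_simps [simp]:
  "ceval z 0 = 0" "ceval z 1 = 1"
  "ceval z (p + q) = ceval z p + ceval z q"
  "ceval z (- p) = - ceval z p"
  "ceval z (p - q) = ceval z p - ceval z q"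
  "ceval z (p * q) = ceval z p * ceval z q"
  "ceval z (p ^ n) = ceval z p ^ n"
  "ceval z (pCons a p) = of_real a + z * ceval z p"
  "ceval z (smult a p) = of_real a * ceval z p"
proof -
  show add: "ceval z (p + q) = ceval z p + ceval z q" for p q
    by (simp add: ceval_def map_poly_of_real_add)
  show mult: "ceval z (p * q) = ceval z p * ceval z q" for p q
    by (simp add: ceval_def map_poly_of_real_mult)
  show pc: "ceval z (pCons a p) = of_real a + z * ceval z p" for a p
    by (simp add: ceval_def map_poly_pCons)
  show zero: "ceval z 0 = 0"
    by (simp add: ceval_def)
  show one: "ceval z 1 = 1"
    by (simp add: ceval_def)
  show minus: "ceval z (- p) = - ceval z p" for p
    using add[of p "- p"] zero by (simp add: minus_unique)
  show "ceval z (p - q) = ceval z p - ceval z q"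
    using add[of p "- q"] minus[of q] by simp
  show "ceval z (p ^ n) = ceval z p ^ n"
    by (induction n) (simp_all add: mult one)
  show "ceval z (smult a p) = of_real a * ceval z p"
    using mult[of "[:a:]" p] pc[of a 0] zero by simp
qed

lemma ceval_of_real: "ceval (of_real x) p = of_real (poly p x)"
  by (induction p) simp_all

abbreviation qeval :: "complex \<Rightarrow> real poly quat \<Rightarrow> complex quat" where
  "qeval z \<equiv> map_quat (ceval z)"

lemma qeval_mult: "qeval z (p * q) = qeval z p * qeval z q"
  by (simp add: times_quat_def quat.map_sel)

lemma qnorm_qeval: "qnorm (qeval z p) = ceval z (qnorm p)"
  by (simp add: qnorm_def quat.map_sel)

definition qdegree_le :: "nat \<Rightarrow> real poly quat \<Rightarrow> bool" where
  "qdegree_le n p \<longleftrightarrow>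
    degree (qRe p) \<le> n \<and> degree (qI p) \<le> n \<and> degree (qJ p) \<le> n \<and> degree (qK p) \<le> n"

lemma qdegree_le_mult:
  assumes "qdegree_le m p" "qdegree_le n q"
  shows "qdegree_le (m + n) (p * q)"
proof -
  have "degree (x * y) \<le> m + n" if "degree x \<le> m" "degree y \<le> n" for x y :: "real poly"
    using degree_mult_le[of x y] that by linarith
  then show ?thesis
    using assms unfolding qdegree_le_def times_quat_def quat.sel
    by (intro conjI degree_add_le degree_diff_le) auto
qed

section \<open>Real quadratic and quaternionic linear factors\<close>

definition quad :: "real \<Rightarrow> real \<Rightarrow> real poly" where
  "quad a b = [:- a, 1:]\<^sup>2 + [:b\<^sup>2:]"

text \<open>The linear polynomial \<open>t - (a + b u)\<close>, where the vector \<open>u\<close> is read as an imaginary quaternion.\<close>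

definition lin :: "real \<Rightarrow> real \<Rightarrow> real ^ 3 \<Rightarrow> real poly quat" where
  "lin a b u = Quat [:- a, 1:] [:- b * u $ 1:] [:- b * u $ 2:] [:- b * u $ 3:]"

lemma quad_pCons: "quad a b = [:a\<^sup>2 + b\<^sup>2, - 2 * a, 1:]"
  by (simp add: quad_def power2_eq_square)

lemma quad_nonzero [simp]: "quad a b \<noteq> 0"
  by (simp add: quad_pCons)

lemma degree_quad [simp]: "degree (quad a b) = 2"
  by (simp add: quad_pCons)

lemma ceval_quad: "ceval z (quad a b) = (z - of_real a)\<^sup>2 + (of_real b)\<^sup>2"
  by (simp add: quad_def)

lemma ceval_quad_Complex: "ceval (Complex a b) (quad a b) = 0"
  by (simp add: ceval_quad complex_eq_iff power2_eq_square)

lemma ceval_quad_eq_0: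
  assumes "ceval z (quad a b) = 0"
  shows "Re z = a" "\<bar>Im z\<bar> = \<bar>b\<bar>"
proof -
  have "(z - of_real a - \<i> * of_real b) * (z - of_real a + \<i> * of_real b) = ceval z (quad a b)"
    by (simp add: ceval_quad power2_eq_square algebra_simps)
  with assms have "z - of_real a - \<i> * of_real b = 0 \<or> z - of_real a + \<i> * of_real b = 0"
    by simp
  then show "Re z = a" "\<bar>Im z\<bar> = \<bar>b\<bar>"
    by (auto simp: complex_eq_iff)
qed

text \<open>The remainder is real of degree at most 1. As \<open>b\<close> is not 0, vanishing at a
  non-real point forces it to be 0.\<close>

lemma quad_dvd:
  assumes "ceval (Complex a b) p = 0" "b \<noteq> 0"
  shows "quad a b dvd p"
proof -
  define r where "r = p mod quad a b"
  have "degree r < 2"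
    using degree_mod_less[of "quad a b" p] by (auto simp: r_def)
  then obtain x y where r: "r = [:x, y:]"
    by (intro that[of "coeff r 0" "coeff r 1"] poly_eqI)
      (auto simp: coeff_pCons coeff_eq_0 split: nat.split)
  have "ceval (Complex a b) p = ceval (Complex a b) (p div quad a b * quad a b + r)"
    by (simp only: r_def div_mult_mod_eq)
  also have "\<dots> = ceval (Complex a b) r"
    by (simp add: ceval_quad_Complex del: div_mult_mod_eq)
  finally have "r = 0"
    using assms by (auto simp: r complex_eq_iff)
  then show ?thesis
    by (simp add: r_def mod_eq_0_iff_dvd)
qed

lemma norm_vec3: "(norm u)\<^sup>2 = (u $ 1)\<^sup>2 + (u $ 2)\<^sup>2 + (u $ 3)\<^sup>2" for u :: "real ^ 3"
  by (simp add: norm_vec_def L2_set_def sum_3)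

lemma qnorm_lin:
  assumes "norm u = 1"
  shows "qnorm (lin a b u) = quad a b"
proof -
  have "(u $ 1)\<^sup>2 + (u $ 2)\<^sup>2 + (u $ 3)\<^sup>2 = 1"
    using norm_vec3[of u] assms by simp
  then have "b\<^sup>2 = (b * u $ 1)\<^sup>2 + (b * u $ 2)\<^sup>2 + (b * u $ 3)\<^sup>2"
    by (simp add: power_mult_distrib flip: distrib_left)
  then show ?thesis
    by (simp add: qnorm_def lin_def quad_def power2_eq_square)
qed

lemma qcnj_lin: "qcnj (lin a b u) = lin a b (- u)"
  by (simp add: qcnj_def lin_def)

lemma lin_mult_lin_minus: "norm u = 1 \<Longrightarrow> lin a b u * lin a b (- u) = scalar (quad a b)"
  by (simp add: mult_qcnj qnorm_lin flip: qcnj_lin)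

lemma qdegree_le_lin: "qdegree_le 1 (lin a b u)"
  by (simp add: qdegree_le_def lin_def)

section \<open>Isotropic values and left linear factors\<close>

definition qprimitive :: "real poly quat \<Rightarrow> bool" where
  "qprimitive p \<longleftrightarrow> (\<forall>z. qeval z p \<noteq> 0)"

lemma lin_eval: "qeval (Complex a b) (lin a b u) =
    Quat (\<i> * b) (- b * u $ 1) (- b * u $ 2) (- b * u $ 3)"
  by (simp add: lin_def complex_eq_iff)

text \<open>Write e = r + i m with real quaternions r and m. Norm 0 means that r and m are
  orthogonal of equal norm n. Then f = m conj(r) is imaginary, and u = f / n is a unit with u r = m
  and u m = - r, so (i + u) (r + i m) = 0.\<close>

lemma quat_isotropic:
  fixes e :: "complex quat"
  assumes "qnorm e = 0" "e \<noteq> 0"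
  obtains u :: "real ^ 3" where "norm u = 1" "Quat \<i> (u $ 1) (u $ 2) (u $ 3) * e = 0"
proof -
  define r m where "r = map_quat Re e" and "m = map_quat Im e"
  define n where "n = qnorm r"
  have orth: "qRe m * qRe r + qI m * qI r + qJ m * qJ r + qK m * qK r = 0"
    using arg_cong[OF assms(1), of Im]
    by (simp add: qnorm_def r_def m_def quat.map_sel power2_eq_square algebra_simps)
  have nm: "qnorm m = n"
    using arg_cong[OF assms(1), of Re]
    by (simp add: n_def qnorm_def r_def m_def quat.map_sel power2_eq_square algebra_simps)
  have "n \<noteq> 0"
  proof
    assume "n = 0"
    then have "qRe r = 0 \<and> qI r = 0 \<and> qJ r = 0 \<and> qK r = 0"
      "qRe m = 0 \<and> qI m = 0 \<and> qJ m = 0 \<and> qK m = 0"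
      using nm unfolding n_def qnorm_def
      by (smt (verit) zero_le_power2 power_eq_0_iff)+
    with assms(2) show False
      by (simp add: r_def m_def quat.map_sel zero_quat_def quat.expand complex_eq_iff)
  qed
  define f where "f = m * qcnj r"
  have fr: "f * r = scalar n * m"
    by (simp add: f_def mult.assoc qcnj_mult n_def scalar_commute)
  \<comment> \<open>The real part of \<open>f\<close> is the inner product of \<open>m\<close> and
    \<open>r\<close>, which is 0; hence \<open>f\<close> is minus its conjugate.\<close>
  have "f = - (r * qcnj m)"
    using orth by (simp add: f_def quat_defs qcnj_def algebra_simps)
  then have fm: "f * m = - (scalar n * r)"
    by (simp add: mult.assoc qcnj_mult nm scalar_commute)
  have f0: "qRe f = 0"
    using orth by (simp add: f_def times_quat_def qcnj_def)
  have "qnorm (qcnj r) = n"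
    by (simp add: n_def qnorm_def qcnj_def)
  then have nf: "qnorm f = n\<^sup>2"
    by (simp add: f_def qnorm_mult nm power2_eq_square)
  define u :: "real ^ 3" where "u = vector [qI f / n, qJ f / n, qK f / n]"
  have u: "u $ 1 = qI f / n" "u $ 2 = qJ f / n" "u $ 3 = qK f / n"
    by (simp_all add: u_def)
  have "(norm u)\<^sup>2 = qnorm f / n\<^sup>2"
    using f0 by (simp add: norm_vec3 u qnorm_def power_divide add_divide_distrib)
  then have "norm u = 1"
    using nf \<open>n \<noteq> 0\<close> by (simp add: power2_eq_1_iff) (smt (verit) norm_ge_zero)
  moreover have "Quat (\<i> * n) (qI f) (qJ f) (qK f) * e = 0"
    using fr fm f0
    unfolding times_quat_def scalar_def uminus_quat_def zero_quat_def r_def m_def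
    by (simp add: quat.map_sel complex_eq_iff)
  then have "scalar (of_real n) * (Quat \<i> (u $ 1) (u $ 2) (u $ 3) * e) = 0"
    using \<open>n \<noteq> 0\<close> by (simp add: u scalar_mult_left mult.commute flip: mult.assoc)
  then have "Quat \<i> (u $ 1) (u $ 2) (u $ 3) * e = 0"
    using \<open>n \<noteq> 0\<close> by (simp add: scalar_mult_eq_0[of "complex_of_real n"])
  ultimately show ?thesis
    by (rule that)
qed

text \<open>
  A factor \<open>(t - a)\<^sup>2 + b\<^sup>2\<close> of the norm splits off a left linear factor: at \<open>t = a + b \<i>\<close> the
  polynomial takes an isotropic value, which is annihilated by \<open>t - (a - b u)\<close> for a suitable unit
  vector \<open>u\<close>.
\<close>

lemma left_factor:
  assumes "qprimitive p" "qnorm p = quad a b * R" "b \<noteq> 0" "qdegree_le (Suc n) p"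
  obtains u q where "norm u = 1" "p = lin a b u * q" "qnorm q = R" "qprimitive q" "qdegree_le n q"
proof -
  define z where "z = Complex a b"
  have "qnorm (qeval z p) = 0"
    by (simp add: qnorm_qeval assms(2) z_def ceval_quad_Complex)
  with assms(1) obtain u :: "real ^ 3"
    where u: "norm u = 1" "Quat \<i> (u $ 1) (u $ 2) (u $ 3) * qeval z p = 0"
    by (auto simp: qprimitive_def intro: quat_isotropic)
  define g where "g = lin a b (- u) * p"
  have "qeval z g = scalar (of_real b) * (Quat \<i> (u $ 1) (u $ 2) (u $ 3) * qeval z p)"
    unfolding mult.assoc[symmetric] g_def qeval_mult z_def lin_eval
    by (simp add: scalar_mult_left mult.commute)
  then have g0: "qeval z g = 0"
    using u by simp
  have dvd: "quad a b dvd qRe g" "quad a b dvd qI g" "quad a b dvd qJ g" "quad a b dvd qK g"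
    using arg_cong[OF g0, of qRe] arg_cong[OF g0, of qI] arg_cong[OF g0, of qJ]
      arg_cong[OF g0, of qK] \<open>b \<noteq> 0\<close>
    by (auto intro!: quad_dvd simp: zero_quat_def z_def quat.map_sel)
  define q where "q = Quat (qRe g div quad a b) (qI g div quad a b)
    (qJ g div quad a b) (qK g div quad a b)"
  have g: "g = scalar (quad a b) * q"
    using dvd by (simp add: q_def scalar_mult_left quat.expand)
  \<comment> \<open>Multiplying by \<open>lin a b u\<close> undoes \<open>lin a b (- u)\<close> up
    to the scalar \<open>quad a b\<close>, which also divides \<open>g\<close> and can be
    cancelled.\<close>
  have "scalar (quad a b) * p = lin a b u * g"
    using u by (simp add: g_def lin_mult_lin_minus flip: mult.assoc)
  also have "\<dots> = scalar (quad a b) * (lin a b u * q)"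
    by (simp add: g scalar_commute flip: mult.assoc)
  finally have p: "p = lin a b u * q"
    by (rule scalar_mult_cancel) simp
  have "quad a b * qnorm q = quad a b * R"
    using assms(2) u by (simp add: p qnorm_mult qnorm_lin)
  then have "qnorm q = R"
    by simp
  moreover have "qprimitive q"
    using assms(1) unfolding qprimitive_def p qeval_mult by (metis mult_zero_right)
  \<comment> \<open>The degree of \<open>g\<close> is at most n + 2, and the scalar removed from it
    has degree exactly 2.\<close>
  moreover have degree_cancel: "degree x \<le> n" if "degree (quad a b * x) \<le> Suc (Suc n)" for x
    using that by (cases "x = 0") (simp_all add: degree_mult_eq)
  have "qdegree_le (1 + Suc n) g"
    unfolding g_def by (intro qdegree_le_mult qdegree_le_lin assms)
  then have "qdegree_le n q"
    using degree_cancel unfolding g qdegree_le_def scalar_mult_left by simp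
  ultimately show ?thesis
    using u p that by blast
qed

text \<open>If \<open>u = - v\<close>, the two linear factors would multiply to the scalar
  \<open>quad a b\<close>, and \<open>p\<close> would vanish at a + b i, against
  primitivity.\<close>

lemma left_factor_twice:
  assumes "qprimitive p" "qnorm p = (quad a b)\<^sup>2 * R" "b \<noteq> 0" "qdegree_le (Suc (Suc n)) p"
  obtains u v q where "norm u = 1" "norm v = 1" "u \<noteq> - v" "p = lin a b u * lin a b v * q"
    "qnorm q = R" "qprimitive q" "qdegree_le n q"
proof -
  obtain u p' where u: "norm u = 1" "p = lin a b u * p'" "qnorm p' = quad a b * R" "qprimitive p'"
      "qdegree_le (Suc n) p'"
    using left_factor[of p a b "quad a b * R" "Suc n"] assms by (auto simp: power2_eq_square mult.assoc)
  obtain v q where v: "norm v = 1" "p' = lin a b v * q" "qnorm q = R" "qprimitive q"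
      "qdegree_le n q"
    using left_factor[OF u(4,3) assms(3) u(5)] by blast
  have "u \<noteq> - v"
  proof
    assume "u = - v"
    then have "lin a b u * lin a b v = scalar (quad a b)"
      using lin_mult_lin_minus[of u] u by simp
    then have "qeval (Complex a b) p = 0"
      by (simp add: u(2) v(2) scalar_mult_left ceval_quad_Complex zero_quat_def flip: mult.assoc)
    with assms(1) show False
      by (simp add: qprimitive_def)
  qed
  then show ?thesis
    using that[of u v q] u v by (simp add: mult.assoc)
qed

text \<open>
  With \<open>w = z - a = \<plusminus> b \<i>\<close>, the components of \<open>(w - b u) (w - b v)\<close> along the imaginary quaternions
  are those of \<open>- w b (u + v) + b\<^sup>2 (u \<times> v)\<close>; as complex numbers, they have imaginary part
  \<open>\<plusminus> b\<^sup>2 (u + v)\<close>.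
\<close>

lemma lin_lin_eval_nonzero:
  assumes "ceval z (quad a b) = 0" "b \<noteq> 0" "u \<noteq> - v"
  shows "qeval z (lin a b u * lin a b v) \<noteq> 0"
proof
  assume 0: "qeval z (lin a b u * lin a b v) = 0"
  have z: "Re z = a" "Im z = b \<or> Im z = - b"
    using ceval_quad_eq_0[OF assms(1)] by auto
  have "b * (b * (u $ i + v $ i)) = 0" if "i \<in> {1, 2, 3}" for i
    using 0 z that
    by (auto simp: qeval_mult lin_def times_quat_def zero_quat_def complex_eq_iff algebra_simps)
  with assms(2) have "u = - v"
    by (simp add: vec_eq_iff forall_3 eq_neg_iff_add_eq_0)
  with assms(3) show False
    by contradiction
qed

section \<open>Quadratic factorization of real polynomials without real roots\<close>

lemma quad_list_factorization:
  assumes "degree p = 2 * n" "\<And>x. poly p x \<noteq> 0"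
  shows "\<exists>l xs. l \<noteq> 0 \<and> length xs = n \<and> (\<forall>(a, b)\<in>set xs. b > 0) \<and>
    p = smult l (prod_list (map (case_prod quad) xs))"
  using assms
proof (induction n arbitrary: p)
  case 0
  then obtain l where "p = [:l:]"
    by (auto elim: degree_eq_zeroE)
  with 0 show ?case
    by (intro exI[of _ l] exI[of _ "[]"]) auto
next
  case (Suc n)
  have "\<not> constant (poly (map_poly complex_of_real p))"
    using Suc.prems by (simp add: constant_degree degree_map_poly)
  then obtain z where z: "ceval z p = 0"
    using fundamental_theorem_of_algebra by (auto simp: ceval_def)
  have "Im z \<noteq> 0"
  proof
    assume "Im z = 0"
    then have "z = of_real (Re z)"
      by (simp add: complex_eq_iff)
    then show False
      using z Suc.prems(2)[of "Re z"] ceval_of_real[of "Re z" p] by simp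
  qed
  then have "quad (Re z) (Im z) dvd p"
    using z by (intro quad_dvd) simp_all
  \<comment> \<open>Only the square of the imaginary part enters, so it can be made
    positive.\<close>
  moreover have "quad (Re z) (Im z) = quad (Re z) \<bar>Im z\<bar>"
    by (simp add: quad_def)
  ultimately obtain q where q: "p = quad (Re z) \<bar>Im z\<bar> * q"
    by (auto elim: dvdE)
  have "q \<noteq> 0"
    using Suc.prems(2) by (auto simp: q)
  then have "degree q = 2 * n"
    using Suc.prems(1) by (simp add: q degree_mult_eq)
  moreover have "poly q x \<noteq> 0" for x
    using Suc.prems(2)[of x] by (auto simp: q)
  ultimately obtain l xs where "l \<noteq> 0" "length xs = n" "\<forall>(a, b)\<in>set xs. b > 0"
      "q = smult l (prod_list (map (case_prod quad) xs))"
    using Suc.IH by blast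
  then show ?case
    using \<open>Im z \<noteq> 0\<close> by (intro exI[of _ l] exI[of _ "(Re z, \<bar>Im z\<bar>) # xs"]) (auto simp: q)
qed

lemma sextic_quad_factorization:
  assumes "degree p = 6" "\<And>x. poly p x \<noteq> 0"
  obtains l a1 b1 a2 b2 a3 b3 where "l \<noteq> 0" "b1 > 0" "b2 > 0" "b3 > 0" "a1 \<le> a2" "a2 \<le> a3"
    "p = smult l (quad a1 b1 * quad a2 b2 * quad a3 b3)"
proof -
  obtain l xs where xs: "l \<noteq> 0" "length xs = 3" "\<forall>(a, b)\<in>set xs. b > 0"
      "p = smult l (prod_list (map (case_prod quad) xs))"
    using quad_list_factorization[of p 3] assms by auto
  \<comment> \<open>Sorting by the real parts of the roots keeps the product and gives
    \<open>a1 \<le> a2 \<le> a3\<close>.\<close>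
  define ys where "ys = sort_key fst xs"
  have "prod_list (map (case_prod quad) ys) = prod_list (map (case_prod quad) xs)"
    by (simp add: ys_def flip: prod_mset_prod_list)
  moreover have "length ys = 3" "\<forall>(a, b)\<in>set ys. b > 0" "sorted (map fst ys)"
    using xs by (simp_all add: ys_def)
  moreover from this(1) obtain a1 b1 a2 b2 a3 b3 where "ys = [(a1, b1), (a2, b2), (a3, b3)]"
    by (auto simp: numeral_3_eq_3 length_Suc_conv)
  ultimately show ?thesis
    using xs that[of l b1 b2 b3 a1 a2 a3] by (simp add: mult.assoc)
qed

section \<open>The index types \<open>5\<close> and \<open>7\<close>\<close>

lemma forall_5: "(\<forall>i::5. P i) \<longleftrightarrow> P 0 \<and> P 1 \<and> P 2 \<and> P 3 \<and> P 4"
proof -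
  have "i \<in> {0, 1, 2, 3, 4}" for i :: 5
  proof (cases i)
    case (of_int z)
    then have "z = 0 \<or> z = 1 \<or> z = 2 \<or> z = 3 \<or> z = 4"
      by auto
    then show ?thesis
      using of_int by auto
  qed
  then show ?thesis
    by (metis empty_iff insert_iff)
qed

lemma bij_betw_of_nat_7: "bij_betw of_nat {..6} (UNIV :: 7 set)"
proof -
  have "inj_on (of_nat :: nat \<Rightarrow> 7) {..6}"
  proof (rule linorder_inj_onI)
    fix k l :: nat
    assume "k < l" "l \<in> {..6}"
    then show "(of_nat k :: 7) \<noteq> of_nat l"
      using of_nat_eq_iff_char_dvd[of k l, where 'a = 7] by (auto dest: dvd_imp_le)
  qed auto
  moreover from this have "of_nat ` {..6} = (UNIV :: 7 set)"
    by (intro card_subset_eq) (simp_all add: card_image)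
  ultimately show ?thesis
    by (simp add: bij_betw_def)
qed

section \<open>Dehomogenization\<close>

text \<open>This sets s = 1, which reverses the indices: \<open>a $ 0\<close> becomes the
  coefficient of t^6 and records the value at the point s = 0, t = 1 at infinity.\<close>

definition dehom :: "real ^ 7 \<Rightarrow> real poly" where
  "dehom a = (\<Sum>k\<le>6. monom (a $ of_nat k) (6 - k))"

text \<open>\<open>inv_into\<close> reads an index of type \<open>7\<close> as its representative
  among 0, ..., 6.\<close>

definition sextic_coeffs :: "real poly \<Rightarrow> real ^ 7" where
  "sextic_coeffs p = (\<chi> j. coeff p (6 - inv_into {..6} of_nat j))"

lemma sextic_coeffs_nth: "k \<le> 6 \<Longrightarrow> sextic_coeffs p $ of_nat k = coeff p (6 - k)"
  using bij_betw_of_nat_7 by (simp add: sextic_coeffs_def bij_betw_def inv_into_f_f)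

lemma coeff_dehom: "coeff (dehom a) n = (if n \<le> 6 then a $ of_nat (6 - n) else 0)"
proof -
  have "coeff (dehom a) n = (\<Sum>k\<le>6. if 6 - k = n then a $ of_nat k else 0)"
    by (simp add: dehom_def coeff_sum)
  also have "\<dots> = (\<Sum>k\<in>{..6} \<inter> {k. 6 - k = n}. a $ of_nat k)"
    by (simp add: sum.inter_restrict)
  also have "{..6} \<inter> {k. 6 - k = n} = (if n \<le> 6 then {6 - n} else {})"
    by auto
  finally show ?thesis
    by simp
qed

lemma degree_dehom_le: "degree (dehom a) \<le> 6"
  by (rule degree_le) (simp add: coeff_dehom)

lemma dehom_sextic_coeffs: "degree p \<le> 6 \<Longrightarrow> dehom (sextic_coeffs p) = p"
  using sextic_coeffs_nth[of "6 - n" p for n]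
  by (intro poly_eqI) (auto simp: coeff_dehom coeff_eq_0 simp del: of_nat_diff)

lemma sextic_coeffs_dehom: "sextic_coeffs (dehom a) = a"
proof -
  have "sextic_coeffs (dehom a) $ j = a $ j" for j
  proof -
    have "j \<in> of_nat ` {..6}"
      using bij_betw_of_nat_7 by (simp add: bij_betw_def)
    then show ?thesis
      by (auto simp: sextic_coeffs_nth coeff_dehom)
  qed
  then show ?thesis
    by (simp add: vec_eq_iff)
qed

lemma ceval_dehom: "ceval z (dehom a) = (\<Sum>k\<le>6. of_real (a $ of_nat k) * z ^ (6 - k))"
proof -
  have "ceval z (\<Sum>k\<in>A. monom (f k) (g k)) = (\<Sum>k\<in>A. of_real (f k) * z ^ g k)"
    if "finite A" for A :: "nat set" and f g
    using that
    by (induction A) (simp_all add: ceval_def map_poly_of_real_add map_poly_monom poly_monom)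
  then show ?thesis
    by (simp add: dehom_def)
qed

lemma homogenize_power:
  fixes s t :: "'a::field"
  assumes "s \<noteq> 0" "k \<le> n"
  shows "s ^ k * t ^ (n - k) = s ^ n * (t / s) ^ (n - k)"
proof -
  have "s ^ n = s ^ k * s ^ (n - k)"
    using assms by (simp flip: power_add)
  then show ?thesis
    using assms by (simp add: power_divide)
qed

lemma eval_complex_sextic_form_dehom:
  assumes "s \<noteq> 0"
  shows "eval_complex (sextic_form a) s t = s ^ 6 * ceval (t / s) (dehom a)"
proof -
  have "s ^ k * t ^ (6 - k) = s ^ 6 * (t / s) ^ (6 - k)" if "k \<le> 6" for k
    using assms that by (rule homogenize_power)
  then show ?thesis
    by (simp add: eval_complex_sextic_form ceval_dehom sum_distrib_left mult.assoc mult.left_commute)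
qed

lemma eval_complex_sextic_form_0: "eval_complex (sextic_form a) 0 t = of_real (a $ 0) * t ^ 6"
  by (simp add: eval_complex_sextic_form power_0_left if_distrib if_distribR cong: if_cong)

text \<open>The projective line is the affine chart, where s is not 0, together with the point s =
  0, where only the t^6 term of each form survives.\<close>

lemma no_common_root_iff:
  "no_common_root c \<longleftrightarrow> (\<exists>i. c $ i $ 0 \<noteq> 0) \<and> (\<forall>z. \<exists>i. ceval z (dehom (c $ i)) \<noteq> 0)"
proof (intro iffI conjI allI)
  assume c: "no_common_root c"
  show "\<exists>i. c $ i $ 0 \<noteq> 0"
    using c unfolding no_common_root_def
    by (metis eval_complex_sextic_form_0 mult_zero_left of_real_0 prod.inject zero_neq_one)
  show "\<exists>i. ceval z (dehom (c $ i)) \<noteq> 0" for z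
    using c unfolding no_common_root_def
    by (metis eval_complex_sextic_form_dehom[of 1 _ z] div_by_1 mult_zero_right prod.inject
        zero_neq_one)
next
  assume c: "(\<exists>i. c $ i $ 0 \<noteq> 0) \<and> (\<forall>z. \<exists>i. ceval z (dehom (c $ i)) \<noteq> 0)"
  have "\<exists>i. eval_complex (sextic_form (c $ i)) s t \<noteq> 0" if "(s, t) \<noteq> (0, 0)" for s t
  proof (cases "s = 0")
    case True
    with that c show ?thesis
      by (auto simp: eval_complex_sextic_form_0)
  next
    case False
    with c show ?thesis
      by (simp add: eval_complex_sextic_form_dehom)
  qed
  then show "no_common_root c"
    by (auto simp: no_common_root_def)
qed

section \<open>Testing identities of forms by real values\<close>

definition form_eval :: "real poly poly \<Rightarrow> real \<Rightarrow> real \<Rightarrow> real" where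
  "form_eval F s t = poly (poly F [:t:]) s"

lemma form_eval_sextic_form:
  "form_eval (sextic_form a) s t = (\<Sum>k\<le>6. a $ of_nat k * s ^ k * t ^ (6 - k))"
  by (simp add: form_eval_def sextic_form_def poly_sum poly_monom poly_const_pow mult_ac)

lemma form_eval_sextic_form_1: "form_eval (sextic_form a) 1 t = poly (dehom a) t"
  by (simp add: form_eval_sextic_form dehom_def poly_sum poly_monom)

lemma form_eval_sextic_form_0: "form_eval (sextic_form a) 0 1 = a $ 0"
  by (simp add: form_eval_sextic_form power_0_left if_distrib if_distribR cong: if_cong)

lemma form_eval_sextic_form_dehom:
  assumes "s \<noteq> 0"
  shows "form_eval (sextic_form a) s t = s ^ 6 * poly (dehom a) (t / s)"
proof -
  have "s ^ k * t ^ (6 - k) = s ^ 6 * (t / s) ^ (6 - k)" if "k \<le> 6" for k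
    using assms that by (rule homogenize_power)
  then show ?thesis
    by (simp add: form_eval_sextic_form dehom_def poly_sum poly_monom sum_distrib_left
        mult.assoc mult.left_commute)
qed

lemma infinite_nonzero_reals: "infinite {s::real. s \<noteq> 0}"
proof -
  have "{s::real. s \<noteq> 0} = UNIV - {0}"
    by auto
  then show ?thesis
    by (simp add: infinite_UNIV_char_0)
qed

lemma poly_eq_if_infinite:
  fixes p q :: "'a::idom poly"
  assumes "infinite X" "\<And>x. x \<in> X \<Longrightarrow> poly p x = poly q x"
  shows "p = q"
proof (rule ccontr)
  assume "p \<noteq> q"
  then have "finite {x. poly (p - q) x = 0}"
    by (intro poly_roots_finite) simp
  moreover have "X \<subseteq> {x. poly (p - q) x = 0}"
    using assms by auto
  ultimately show False
    using assms(1) finite_subset by blast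
qed

text \<open>Infinitely many constants for the outer variable, then infinitely many values of the
  inner one, determine the polynomial. Omitting s = 0 allows the dehomogenization formula to be
  used.\<close>

lemma form_eqI:
  assumes "\<And>s t. s \<noteq> 0 \<Longrightarrow> form_eval F s t = form_eval G s t"
  shows "F = G"
proof (rule poly_eq_if_infinite)
  show "infinite (range (\<lambda>t::real. [:t:]))"
    by (simp add: finite_image_iff inj_def infinite_UNIV_char_0)
  fix x :: "real poly"
  assume "x \<in> range (\<lambda>t. [:t:])"
  then obtain t where x: "x = [:t:]"
    by blast
  show "poly F x = poly G x"
    using assms unfolding x form_eval_def
    by (intro poly_eq_if_infinite[OF infinite_nonzero_reals]) auto
qed

definition qpart :: "real ^ 7 ^ 5 \<Rightarrow> real poly quat" where
  "qpart c = Quat (dehom (c $ 1)) (dehom (c $ 2)) (dehom (c $ 3)) (dehom (c $ 4))"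

lemma on_S3_form_eval:
  assumes "on_S3 c"
  shows "(form_eval (sextic_form (c $ 1)) s t)\<^sup>2 + (form_eval (sextic_form (c $ 2)) s t)\<^sup>2 +
    (form_eval (sextic_form (c $ 3)) s t)\<^sup>2 + (form_eval (sextic_form (c $ 4)) s t)\<^sup>2 =
    (form_eval (sextic_form (c $ 0)) s t)\<^sup>2"
  using arg_cong[OF assms[unfolded on_S3_def], of "\<lambda>F. form_eval F s t"]
  by (simp add: form_eval_def)

text \<open>One direction puts s = 1. The other multiplies by (s^6)^2, which recovers the identity
  of forms wherever s is not 0.\<close>

lemma on_S3_iff: "on_S3 c \<longleftrightarrow> qnorm (qpart c) = (dehom (c $ 0))\<^sup>2"
proof
  assume "on_S3 c"
  then have "poly (qnorm (qpart c)) x = poly ((dehom (c $ 0))\<^sup>2) x" for x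
    using on_S3_form_eval[of c 1 x]
    by (simp add: qnorm_def qpart_def form_eval_sextic_form_1)
  then show "qnorm (qpart c) = (dehom (c $ 0))\<^sup>2"
    by (simp add: poly_eq_poly_eq_iff[symmetric] fun_eq_iff)
next
  assume eq: "qnorm (qpart c) = (dehom (c $ 0))\<^sup>2"
  show "on_S3 c"
    unfolding on_S3_def
  proof (rule form_eqI)
    fix s t :: real
    assume "s \<noteq> 0"
    then show "form_eval ((sextic_form (c $ 1))\<^sup>2 + (sextic_form (c $ 2))\<^sup>2 +
        (sextic_form (c $ 3))\<^sup>2 + (sextic_form (c $ 4))\<^sup>2) s t =
      form_eval ((sextic_form (c $ 0))\<^sup>2) s t"
      using arg_cong[OF eq, of "\<lambda>p. (s ^ 6)\<^sup>2 * poly p (t / s)"]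
        form_eval_sextic_form_dehom[OF \<open>s \<noteq> 0\<close>]
      by (simp add: form_eval_def qnorm_def qpart_def power_mult_distrib distrib_left)
  qed
qed

section \<open>Families of polynomials\<close>

text \<open>Coefficientwise continuity suffices, because \<open>sextic_coeffs\<close> only reads
  coefficients.\<close>

definition poly_continuous_on :: "'a::topological_space set \<Rightarrow> ('a \<Rightarrow> real poly) \<Rightarrow> bool" where
  "poly_continuous_on S P \<longleftrightarrow> (\<forall>n. continuous_on S (\<lambda>d. coeff (P d) n))"

named_theorems poly_continuous_intros

lemma poly_continuous_on_0 [poly_continuous_intros]: "poly_continuous_on S (\<lambda>d. 0)"
  by (simp add: poly_continuous_on_def)

lemma poly_continuous_on_pCons [poly_continuous_intros]:
  "continuous_on S f \<Longrightarrow> poly_continuous_on S P \<Longrightarrow> poly_continuous_on S (\<lambda>d. pCons (f d) (P d))"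
  unfolding poly_continuous_on_def
proof
  fix n
  assume "continuous_on S f" "\<forall>n. continuous_on S (\<lambda>d. coeff (P d) n)"
  then show "continuous_on S (\<lambda>d. coeff (pCons (f d) (P d)) n)"
    by (cases n) simp_all
qed

lemma poly_continuous_on_add [poly_continuous_intros]:
  "poly_continuous_on S P \<Longrightarrow> poly_continuous_on S Q \<Longrightarrow> poly_continuous_on S (\<lambda>d. P d + Q d)"
  by (simp add: poly_continuous_on_def continuous_on_add)

lemma poly_continuous_on_diff [poly_continuous_intros]:
  "poly_continuous_on S P \<Longrightarrow> poly_continuous_on S Q \<Longrightarrow> poly_continuous_on S (\<lambda>d. P d - Q d)"
  by (simp add: poly_continuous_on_def continuous_on_diff)

lemma poly_continuous_on_mult [poly_continuous_intros]:
  "poly_continuous_on S P \<Longrightarrow> poly_continuous_on S Q \<Longrightarrow> poly_continuous_on S (\<lambda>d. P d * Q d)"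
  by (simp add: poly_continuous_on_def coeff_mult continuous_on_sum continuous_on_mult)

lemma poly_continuous_on_smult [poly_continuous_intros]:
  "continuous_on S f \<Longrightarrow> poly_continuous_on S P \<Longrightarrow> poly_continuous_on S (\<lambda>d. smult (f d) (P d))"
  by (simp add: poly_continuous_on_def continuous_on_mult)

lemma poly_continuous_on_quad [poly_continuous_intros]:
  "continuous_on S f \<Longrightarrow> continuous_on S g \<Longrightarrow> poly_continuous_on S (\<lambda>d. quad (f d) (g d))"
  unfolding quad_pCons by (intro poly_continuous_intros continuous_intros)

definition qpoly_continuous_on :: "'a::topological_space set \<Rightarrow> ('a \<Rightarrow> real poly quat) \<Rightarrow> bool" where
  "qpoly_continuous_on S P \<longleftrightarrow> poly_continuous_on S (\<lambda>d. qRe (P d)) \<and>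
    poly_continuous_on S (\<lambda>d. qI (P d)) \<and> poly_continuous_on S (\<lambda>d. qJ (P d)) \<and>
    poly_continuous_on S (\<lambda>d. qK (P d))"

lemma qpoly_continuous_on_Quat [poly_continuous_intros]:
  "poly_continuous_on S P \<Longrightarrow> poly_continuous_on S Q \<Longrightarrow> poly_continuous_on S R \<Longrightarrow>
    poly_continuous_on S T \<Longrightarrow> qpoly_continuous_on S (\<lambda>d. Quat (P d) (Q d) (R d) (T d))"
  by (simp add: qpoly_continuous_on_def)

lemma qpoly_continuous_on_mult [poly_continuous_intros]:
  "qpoly_continuous_on S P \<Longrightarrow> qpoly_continuous_on S Q \<Longrightarrow> qpoly_continuous_on S (\<lambda>d. P d * Q d)"
  unfolding qpoly_continuous_on_def times_quat_def quat.sel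
  by (intro conjI poly_continuous_intros; simp)

lemma qpoly_continuous_on_lin [poly_continuous_intros]:
  "continuous_on S f \<Longrightarrow> continuous_on S g \<Longrightarrow> continuous_on S h \<Longrightarrow>
    qpoly_continuous_on S (\<lambda>d. lin (f d) (g d) (h d))"
  unfolding lin_def by (intro poly_continuous_intros continuous_intros)

lemma continuous_on_sextic_coeffs:
  "poly_continuous_on S P \<Longrightarrow> continuous_on S (\<lambda>d. sextic_coeffs (P d))"
  unfolding sextic_coeffs_def poly_continuous_on_def by (intro continuous_on_vec_lambda) simp

section \<open>The factorized curves\<close>

text \<open>Real and imaginary parts of the roots of \<open>p\<^sub>0\<close>, three pairs of
  imaginary units, and the final constant quaternion.\<close>

type_synonym params =
  "((real ^ 3) \<times> (real ^ 3)) \<times>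
   (((real ^ 3) \<times> (real ^ 3)) \<times> ((real ^ 3) \<times> (real ^ 3)) \<times> ((real ^ 3) \<times> (real ^ 3))) \<times> (real ^ 4)"

definition const_quat :: "real ^ 4 \<Rightarrow> real poly quat" where
  "const_quat c = Quat [:c $ 1:] [:c $ 2:] [:c $ 3:] [:c $ 4:]"

text \<open>The factor is \<open>norm c\<close> and not its square, since the norm of the
  quaternionic polynomial is the square of this one.\<close>

fun param_norm :: "params \<Rightarrow> real poly" where
  "param_norm ((a, b), uv, c) =
    smult (norm c) (quad (a $ 1) (b $ 1) * quad (a $ 2) (b $ 2) * quad (a $ 3) (b $ 3))"

text \<open>Bracketing to the right lets the pairs be cancelled one after the other from the
  left.\<close>

fun param_quat :: "params \<Rightarrow> real poly quat" where
  "param_quat ((a, b), ((u1, v1), (u2, v2), (u3, v3)), c) =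
    lin (a $ 1) (b $ 1) u1 * lin (a $ 1) (b $ 1) v1 *
    (lin (a $ 2) (b $ 2) u2 * lin (a $ 2) (b $ 2) v2 *
    (lin (a $ 3) (b $ 3) u3 * lin (a $ 3) (b $ 3) v3 * const_quat c))"

definition curve :: "real poly \<Rightarrow> real poly quat \<Rightarrow> real ^ 7 ^ 5" where
  "curve P Q = (\<chi> i. sextic_coeffs
    (if i = 0 then P else if i = 1 then qRe Q else if i = 2 then qI Q else if i = 3 then qJ Q
     else qK Q))"

lemma curve_nth:
  "curve P Q $ 0 = sextic_coeffs P" "curve P Q $ 1 = sextic_coeffs (qRe Q)"
  "curve P Q $ 2 = sextic_coeffs (qI Q)" "curve P Q $ 3 = sextic_coeffs (qJ Q)"
  "curve P Q $ 4 = sextic_coeffs (qK Q)"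
  by (simp_all add: curve_def)

lemma qpart_curve: "qdegree_le 6 Q \<Longrightarrow> qpart (curve P Q) = Q"
  by (simp add: qpart_def curve_nth dehom_sextic_coeffs qdegree_le_def)

lemma curve_qpart: "curve (dehom (c $ 0)) (qpart c) = c"
  by (simp add: vec_eq_iff[of "curve _ _"] forall_5 curve_nth qpart_def sextic_coeffs_dehom)

definition param_curve :: "params \<Rightarrow> real ^ 7 ^ 5" where
  "param_curve d = curve (param_norm d) (param_quat d)"

lemma continuous_on_curve:
  assumes "poly_continuous_on S P" "qpoly_continuous_on S Q"
  shows "continuous_on S (\<lambda>d. curve (P d) (Q d))"
  unfolding curve_def
proof (rule continuous_on_vec_lambda)
  fix i :: 5
  show "continuous_on S (\<lambda>d. sextic_coeffs (if i = 0 then P d else if i = 1 then qRe (Q d)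
      else if i = 2 then qI (Q d) else if i = 3 then qJ (Q d) else qK (Q d)))"
    using assms unfolding qpoly_continuous_on_def
    by (cases "i = 0"; cases "i = 1"; cases "i = 2"; cases "i = 3")
      (simp_all add: continuous_on_sextic_coeffs)
qed

lemma continuous_on_param_curve: "continuous_on S param_curve"
proof -
  have "param_norm = (\<lambda>d. smult (norm (snd (snd d))) (quad (fst (fst d) $ 1) (snd (fst d) $ 1) *
      quad (fst (fst d) $ 2) (snd (fst d) $ 2) * quad (fst (fst d) $ 3) (snd (fst d) $ 3)))"
    by (auto simp: fun_eq_iff)
  moreover have "poly_continuous_on S \<dots>"
    by (intro poly_continuous_intros continuous_intros)
  moreover have "param_quat = (\<lambda>d.
      let (a, b) = fst d; ((u1, v1), (u2, v2), (u3, v3)) = fst (snd d); c = snd (snd d) in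
      lin (a $ 1) (b $ 1) u1 * lin (a $ 1) (b $ 1) v1 *
      (lin (a $ 2) (b $ 2) u2 * lin (a $ 2) (b $ 2) v2 *
      (lin (a $ 3) (b $ 3) u3 * lin (a $ 3) (b $ 3) v3 * const_quat c)))"
    by (auto simp: fun_eq_iff)
  moreover have "qpoly_continuous_on S \<dots>"
    unfolding Let_def case_prod_unfold const_quat_def
    by (intro poly_continuous_intros continuous_intros)
  ultimately show ?thesis
    unfolding param_curve_def by (intro continuous_on_curve) simp_all
qed

section \<open>The parameter domain and the absence of common roots\<close>

lemma norm_vec4: "(norm c)\<^sup>2 = (c $ 1)\<^sup>2 + (c $ 2)\<^sup>2 + (c $ 3)\<^sup>2 + (c $ 4)\<^sup>2" for c :: "real ^ 4"
  by (simp add: norm_vec_def L2_set_def sum_4)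

lemma qnorm_const_quat: "qnorm (const_quat c) = [:(norm c)\<^sup>2:]"
  unfolding norm_vec4 by (simp add: const_quat_def qnorm_def power2_eq_square)

text \<open>An antipodal pair would multiply to the scalar \<open>quad a b\<close> and so produce a
  common root.\<close>

definition nonantipodal :: "((real ^ 3) \<times> (real ^ 3)) set" where
  "nonantipodal = {(u, v). norm u = 1 \<and> norm v = 1 \<and> u \<noteq> - v}"

text \<open>Being a product, it allows connectedness and closure to be treated factor by
  factor.\<close>

definition param_dom :: "(real ^ 3) set \<Rightarrow> params set" where
  "param_dom A = (A \<times> {b. \<forall>i. b $ i > 0}) \<times> (nonantipodal \<times> nonantipodal \<times> nonantipodal) \<times> (- {0})"

definition chamber :: "(real ^ 3) set" where
  "chamber = {a. a $ 1 < a $ 2 \<and> a $ 2 < a $ 3}"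

text \<open>On a wall two quadratic factors may coincide and the curve may acquire a common root, so
  \<open>no_common_root\<close> has to be imposed separately there.\<close>

definition closed_chamber :: "(real ^ 3) set" where
  "closed_chamber = {a. a $ 1 \<le> a $ 2 \<and> a $ 2 \<le> a $ 3}"

lemma qdegree_le_const_quat: "qdegree_le 0 (const_quat c)"
  by (simp add: qdegree_le_def const_quat_def)

lemma qdegree_le_param_quat: "qdegree_le 6 (param_quat d)"
proof -
  obtain a b u1 v1 u2 v2 u3 v3 c where d: "d = ((a, b), ((u1, v1), (u2, v2), (u3, v3)), c)"
    by (metis surj_pair)
  have "qdegree_le (1 + 1 + (1 + 1 + (1 + 1 + 0))) (param_quat d)"
    unfolding d param_quat.simps
    by (intro qdegree_le_mult qdegree_le_lin qdegree_le_const_quat)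
  then show ?thesis
    by (simp add: numeral_eq_Suc)
qed

lemma degree_param_norm_le: "degree (param_norm d) \<le> 6"
proof -
  obtain a b uv c where d: "d = ((a, b), uv, c)"
    by (metis surj_pair)
  have "degree (quad (a $ 1) (b $ 1) * quad (a $ 2) (b $ 2) * quad (a $ 3) (b $ 3)) = 6"
    by (simp add: degree_mult_eq)
  then show ?thesis
    by (simp add: d)
qed

lemma qpart_param_curve: "qpart (param_curve d) = param_quat d"
  by (simp add: param_curve_def qpart_curve qdegree_le_param_quat)

lemma dehom_param_curve: "dehom (param_curve d $ 0) = param_norm d"
  by (simp add: param_curve_def curve_nth dehom_sextic_coeffs degree_param_norm_le)

lemma on_S3_param_curve:
  assumes "d \<in> param_dom A"
  shows "on_S3 (param_curve d)"
proof -
  obtain a b u1 v1 u2 v2 u3 v3 c where d: "d = ((a, b), ((u1, v1), (u2, v2), (u3, v3)), c)"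
    by (metis surj_pair)
  with assms show ?thesis
    unfolding on_S3_iff qpart_param_curve dehom_param_curve
    by (simp add: d param_dom_def nonantipodal_def qnorm_mult qnorm_lin qnorm_const_quat
        power2_eq_square mult_ac)
qed

text \<open>At a root of \<open>p\<^sub>0\<close> exactly one quadratic factor vanishes. The other
  pairs and the constant have non-zero norm there and cancel, leaving the value of a single pair,
  which is non-zero by \<open>lin_lin_eval_nonzero\<close>.\<close>

lemma no_common_root_param_curve:
  assumes "d \<in> param_dom chamber"
  shows "no_common_root (param_curve d)"
proof -
  obtain a b u1 v1 u2 v2 u3 v3 c where d: "d = ((a, b), ((u1, v1), (u2, v2), (u3, v3)), c)"
    by (metis surj_pair)
  have ab: "a $ 1 < a $ 2" "a $ 2 < a $ 3" "b $ i > 0" and c: "c \<noteq> 0" for i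
    using assms by (auto simp: d param_dom_def chamber_def)
  have uv: "norm u1 = 1" "norm v1 = 1" "u1 \<noteq> - v1" "norm u2 = 1" "norm v2 = 1" "u2 \<noteq> - v2"
      "norm u3 = 1" "norm v3 = 1" "u3 \<noteq> - v3"
    using assms by (auto simp: d param_dom_def nonantipodal_def)
  define M where "M i = quad (a $ i) (b $ i)" for i
  define L where "L i u v = lin (a $ i) (b $ i) u * lin (a $ i) (b $ i) v" for i u v
  have nL: "qnorm (L i u v) = M i * M i" if "norm u = 1" "norm v = 1" for i u v
    using that by (simp add: L_def M_def qnorm_mult qnorm_lin)
  have Q: "param_quat d = L 1 u1 v1 * (L 2 u2 v2 * (L 3 u3 v3 * const_quat c))"
    by (simp add: d L_def)
  have P: "param_norm d = smult (norm c) (M 1 * M 2 * M 3)"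
    by (simp add: d M_def)
  have nc: "qnorm (qeval z (const_quat c)) \<noteq> 0" for z
    using c by (simp add: qnorm_qeval qnorm_const_quat)
  \<comment> \<open>A root of \<open>M i\<close> has real part \<open>a $ i\<close>, and these are
    pairwise distinct in the open chamber.\<close>
  have M_inj: "i = j" if "ceval z (M i) = 0" "ceval z (M j) = 0" for z i j
  proof -
    have "a $ i = a $ j"
      using that ceval_quad_eq_0(1) unfolding M_def by metis
    moreover have "\<forall>i j. a $ i = a $ j \<longrightarrow> i = j"
      using ab by (simp add: forall_3)
    ultimately show ?thesis
      by blast
  qed
  have L_nz: "qeval z (L i u v) \<noteq> 0" if "ceval z (M i) = 0" "u \<noteq> - v" for z i u v
    using that ab(3)[of i] unfolding L_def M_def by (intro lin_lin_eval_nonzero) auto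
  have "\<exists>i. ceval z (dehom (param_curve d $ i)) \<noteq> 0" for z
  proof (rule ccontr)
    assume "\<not> ?thesis"
    then have "qeval z (qpart (param_curve d)) = 0" "ceval z (dehom (param_curve d $ 0)) = 0"
      by (simp_all add: qpart_def zero_quat_def)
    then have q: "qeval z (L 1 u1 v1) * (qeval z (L 2 u2 v2) * (qeval z (L 3 u3 v3) *
        qeval z (const_quat c))) = 0"
      and p: "ceval z (M 1) = 0 \<or> ceval z (M 2) = 0 \<or> ceval z (M 3) = 0"
      unfolding qpart_param_curve dehom_param_curve Q P using c by (simp_all add: qeval_mult)
    have n: "qnorm (qeval z (L 1 u1 v1)) = (ceval z (M 1))\<^sup>2"
      "qnorm (qeval z (L 2 u2 v2)) = (ceval z (M 2))\<^sup>2"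
      "qnorm (qeval z (L 3 u3 v3)) = (ceval z (M 3))\<^sup>2"
      using uv by (simp_all add: qnorm_qeval nL power2_eq_square)
    consider "ceval z (M 1) = 0" "ceval z (M 2) \<noteq> 0" "ceval z (M 3) \<noteq> 0"
      | "ceval z (M 1) \<noteq> 0" "ceval z (M 2) = 0" "ceval z (M 3) \<noteq> 0"
      | "ceval z (M 1) \<noteq> 0" "ceval z (M 2) \<noteq> 0" "ceval z (M 3) = 0"
      using p M_inj[of z 1 2] M_inj[of z 1 3] M_inj[of z 2 3] by auto
    then show False
    proof cases
      case 1
      have "qeval z (L 1 u1 v1) = 0"
        by (rule qmult_eq_0_right[OF q]) (simp add: qnorm_mult n nc 1)
      with L_nz uv 1 show False by blast
    next
      case 2
      have "qeval z (L 2 u2 v2) * (qeval z (L 3 u3 v3) * qeval z (const_quat c)) = 0"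
        by (rule qmult_eq_0_left[OF q]) (simp add: n 2)
      then have "qeval z (L 2 u2 v2) = 0"
        by (rule qmult_eq_0_right) (simp add: qnorm_mult n nc 2)
      with L_nz uv 2 show False by blast
    next
      case 3
      have "qeval z (L 2 u2 v2) * (qeval z (L 3 u3 v3) * qeval z (const_quat c)) = 0"
        by (rule qmult_eq_0_left[OF q]) (simp add: n 3)
      then have "qeval z (L 3 u3 v3) * qeval z (const_quat c) = 0"
        by (rule qmult_eq_0_left) (simp add: n 3)
      then have "qeval z (L 3 u3 v3) = 0"
        by (rule qmult_eq_0_right) (simp add: nc)
      with L_nz uv 3 show False by blast
    qed
  qed
  \<comment> \<open>There is no common root at infinity either, because \<open>p\<^sub>0\<close> has
    degree exactly 6.\<close>
  moreover have "param_curve d $ 0 $ 0 \<noteq> 0"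
  proof -
    have "degree (M 1 * M 2 * M 3) = 6"
      by (simp add: M_def degree_mult_eq)
    moreover from this have "coeff (M 1 * M 2 * M 3) 6 \<noteq> 0"
      by (metis degree_0 leading_coeff_0_iff zero_neq_numeral)
    ultimately have "coeff (param_norm d) 6 \<noteq> 0"
      using c by (simp add: P)
    then show ?thesis
      unfolding dehom_param_curve[symmetric] by (simp add: coeff_dehom)
  qed
  ultimately show ?thesis
    by (auto simp: no_common_root_iff)
qed

section \<open>Connectedness and density of the open chamber of parameters\<close>

text \<open>
  Before normalization the pairs form the union of the convex sets \<open>H m\<close>, each of which meets the
  connected diagonal.
\<close>

lemma connected_nonantipodal: "connected nonantipodal"
proof -
  define H :: "real ^ 3 \<Rightarrow> ((real ^ 3) \<times> (real ^ 3)) set"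
    where "H m = {x. m \<bullet> x > 0} \<times> {x. m \<bullet> x > 0}" for m
  define D :: "((real ^ 3) \<times> (real ^ 3)) set" where "D = (\<lambda>m. (m, m)) ` (- {0})"
  have "connected D"
    unfolding D_def
    by (intro connected_continuous_image connected_punctured_universe continuous_intros) simp
  moreover have "connected (H m)" for m
    unfolding H_def by (intro convex_connected convex_Times convex_halfspace_gt)
  moreover have "D \<inter> H m \<noteq> {}" if "m \<noteq> 0" for m
    using that by (auto simp: D_def H_def)
  ultimately have "connected (D \<union> \<Union>(H ` (- {0})))"
    by (intro connected_Un_UN) auto
  then have "connected ((\<lambda>(x, y). (sgn x, sgn y)) ` (D \<union> \<Union>(H ` (- {0}))))"
  proof (rule connected_continuous_image[rotated])
    show "continuous_on (D \<union> \<Union>(H ` (- {0}))) (\<lambda>(x, y). (sgn x, sgn y))"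
      unfolding case_prod_unfold by (intro continuous_intros) (auto simp: D_def H_def)
  qed
  also have "(\<lambda>(x, y). (sgn x, sgn y)) ` (D \<union> \<Union>(H ` (- {0}))) = nonantipodal"
  proof (intro equalityI subsetI)
    fix p :: "(real ^ 3) \<times> (real ^ 3)"
    assume "p \<in> (\<lambda>(x, y). (sgn x, sgn y)) ` (D \<union> \<Union>(H ` (- {0})))"
    moreover have "D \<subseteq> \<Union>(H ` (- {0}))"
      by (auto simp: D_def H_def)
    ultimately have "p \<in> (\<lambda>(x, y). (sgn x, sgn y)) ` \<Union>(H ` (- {0}))"
      by (simp add: Un_absorb1)
    then obtain m x y where p: "p = (sgn x, sgn y)" and m: "m \<bullet> x > 0" "m \<bullet> y > 0"
      by (auto simp: H_def simp del: ex_simps)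
    then have "x \<noteq> 0" "y \<noteq> 0" "m \<bullet> sgn x > 0" "m \<bullet> sgn y > 0"
      by (auto simp: sgn_div_norm intro!: mult_pos_pos)
    \<comment> \<open>Antipodal vectors do not lie in a common open half-space.\<close>
    moreover from this have "sgn x \<noteq> - sgn y"
      by (metis inner_minus_right neg_0_less_iff_less order_less_asym)
    ultimately show "p \<in> nonantipodal"
      by (simp add: p nonantipodal_def norm_sgn)
  next
    fix p :: "(real ^ 3) \<times> (real ^ 3)"
    assume "p \<in> nonantipodal"
    then obtain u v where p: "p = (u, v)" and uv: "norm u = 1" "norm v = 1" "u \<noteq> - v"
      by (auto simp: nonantipodal_def)
    \<comment> \<open>The bisector u + v serves as m: its inner product with either vector is 1 + u
      \<bullet> v, half its squared norm.\<close>
    have "(u + v) \<bullet> (u + v) > 0"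
      using uv(3) by (simp add: eq_neg_iff_add_eq_0)
    moreover have "u \<bullet> u = 1" "v \<bullet> v = 1"
      using uv by (simp_all add: norm_eq_1)
    ultimately have "(u + v) \<bullet> u > 0" "(u + v) \<bullet> v > 0"
      by (simp_all add: inner_add_left inner_add_right inner_commute[of v u])
    then have "p \<in> H (u + v)"
      by (simp add: p H_def)
    moreover have "u + v \<noteq> 0"
      using uv by (simp add: eq_neg_iff_add_eq_0)
    moreover have "p = (\<lambda>(x, y). (sgn x, sgn y)) p"
      using uv by (simp add: p sgn_div_norm)
    ultimately show "p \<in> (\<lambda>(x, y). (sgn x, sgn y)) ` (D \<union> \<Union>(H ` (- {0})))"
      by blast
  qed
  finally show ?thesis .
qed

lemma convex_positive: "convex {b :: real ^ 'n. \<forall>i. b $ i > 0}"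
proof -
  have "{b :: real ^ 'n. \<forall>i. b $ i > 0} = (\<Inter>i. {b. axis i 1 \<bullet> b > 0})"
    by (auto simp: inner_axis')
  then show ?thesis
    by (simp only: convex_INT convex_halfspace_gt)
qed

lemma connected_param_dom: "connected (param_dom chamber)"
proof -
  have "convex {a :: real ^ 3. a $ i < a $ j}" for i j
    using convex_halfspace_gt[of 0 "axis j 1 - axis i 1 :: real ^ 3"]
    by (simp add: inner_diff_left inner_axis')
  then have "convex ({a :: real ^ 3. a $ 1 < a $ 2} \<inter> {a. a $ 2 < a $ 3})"
    by (intro convex_Int)
  moreover have "{a :: real ^ 3. a $ 1 < a $ 2} \<inter> {a. a $ 2 < a $ 3} = chamber"
    by (auto simp: chamber_def)
  ultimately have "connected chamber"
    by (simp add: convex_connected)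
  moreover have "connected {b :: real ^ 3. \<forall>i. b $ i > 0}"
    by (intro convex_connected convex_positive)
  ultimately show ?thesis
    by (simp add: param_dom_def connected_nonantipodal connected_punctured_universe)
qed

lemma closed_chamber_subset_closure: "closed_chamber \<subseteq> closure chamber"
proof
  fix a
  assume a: "a \<in> closed_chamber"
  \<comment> \<open>Adding a positive multiple of a vector with increasing entries makes the weak
    inequalities strict.\<close>
  define e :: "real ^ 3" where "e = vector [1, 2, 3]"
  have "((\<lambda>r. a + r *\<^sub>R e) \<longlongrightarrow> a + 0 *\<^sub>R e) (at_right 0)"
    by (intro tendsto_intros)
  moreover have "eventually (\<lambda>r. a + r *\<^sub>R e \<in> chamber) (at_right 0)"
    using eventually_at_right_less
    by eventually_elim (use a in \<open>auto simp: chamber_def closed_chamber_def e_def\<close>)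
  then have "eventually (\<lambda>r. a + r *\<^sub>R e \<in> closure chamber) (at_right 0)"
    by eventually_elim (use closure_subset in blast)
  ultimately have "a + 0 *\<^sub>R e \<in> closure chamber"
    by (intro Lim_in_closed_set[of "closure chamber" "\<lambda>r. a + r *\<^sub>R e" "at_right 0"]) simp_all
  then show "a \<in> closure chamber"
    by simp
qed

lemma param_dom_mono: "A \<subseteq> B \<Longrightarrow> param_dom A \<subseteq> param_dom B"
  by (auto simp: param_dom_def)

lemma param_dom_subset_closure: "param_dom closed_chamber \<subseteq> closure (param_dom chamber)"
  unfolding param_dom_def closure_Times
  by (intro Sigma_mono closed_chamber_subset_closure closure_subset)

section \<open>Existence of parameters\<close>

lemma qnorm_constant:
  assumes "qdegree_le 0 q" "qnorm q = [:r\<^sup>2:]"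
  obtains c where "q = const_quat c" "norm c = \<bar>r\<bar>"
proof -
  define c :: "real ^ 4"
    where "c = (\<chi> i. coeff (if i = 1 then qRe q else if i = 2 then qI q
      else if i = 3 then qJ q else qK q) 0)"
  have q: "q = const_quat c"
    using assms(1)
    by (auto simp: qdegree_le_def const_quat_def c_def quat.expand dest!: degree_0_id)
  have "(norm c)\<^sup>2 = r\<^sup>2"
    using assms(2) by (simp add: q qnorm_const_quat)
  then have "norm c = \<bar>r\<bar>"
    by (metis abs_norm_cancel power2_eq_iff abs_minus_cancel)
  with q show ?thesis
    by (rule that)
qed

text \<open>The sign condition selects one of the representatives \<open>c\<close> and
  \<open>- c\<close>, as \<open>param_norm\<close> is positive on the real line for parameters in
  the domain.\<close>

lemma ex_param:
  assumes root: "no_common_root c" and S3: "on_S3 c" and pos: "poly (dehom (c $ 0)) 0 > 0"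
  shows "\<exists>d\<in>param_dom closed_chamber. param_curve d = c"
proof -
  define P Q where "P = dehom (c $ 0)" and "Q = qpart c"
  have norm_Q: "qnorm Q = P\<^sup>2"
    using S3 by (simp add: on_S3_iff P_def Q_def)
  have sum_0: "x1 = 0 \<and> x2 = 0 \<and> x3 = 0 \<and> x4 = 0"
    if "x1\<^sup>2 + x2\<^sup>2 + x3\<^sup>2 + x4\<^sup>2 = 0" for x1 x2 x3 x4 :: real
    using that by (smt (verit) zero_le_power2 power_eq_0_iff)
  \<comment> \<open>If \<open>p\<^sub>0\<close> vanished at infinity, the sphere equation over the
    reals would make all forms vanish there. Hence \<open>p\<^sub>0\<close> has full degree
    6.\<close>
  have "c $ 0 $ 0 \<noteq> 0"
  proof
    assume "c $ 0 $ 0 = 0"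
    then have "\<forall>i. c $ i $ 0 = 0"
      using on_S3_form_eval[OF S3, of 0 1] sum_0[of "c $ 1 $ 0" "c $ 2 $ 0" "c $ 3 $ 0" "c $ 4 $ 0"]
      by (simp add: form_eval_sextic_form_0 forall_5)
    with root show False
      unfolding no_common_root_iff by blast
  qed
  then have degree_P: "degree P = 6"
    by (intro antisym le_degree) (simp_all add: P_def degree_dehom_le coeff_dehom)
  \<comment> \<open>A zero of \<open>Q\<close> is a zero of its norm, the square of
    \<open>P\<close>, and hence a common root of all five forms.\<close>
  have prim: "qprimitive Q"
    unfolding qprimitive_def
  proof (intro allI notI)
    fix z
    assume Q0: "qeval z Q = 0"
    have "(ceval z P)\<^sup>2 = qnorm (qeval z Q)"
      by (simp add: qnorm_qeval norm_Q)
    with Q0 have "ceval z P = 0"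
      by (simp add: qnorm_def zero_quat_def)
    with Q0 have "\<forall>i. ceval z (dehom (c $ i)) = 0"
      by (simp add: forall_5 P_def Q_def qpart_def zero_quat_def)
    with root show False
      unfolding no_common_root_iff by blast
  qed
  \<comment> \<open>At a real point a vanishing sum of squares forces \<open>Q\<close> to vanish,
    against primitivity.\<close>
  have "poly P x \<noteq> 0" for x
  proof
    assume "poly P x = 0"
    then have "poly (qnorm Q) x = 0"
      by (simp add: norm_Q)
    then have "poly (qRe Q) x = 0 \<and> poly (qI Q) x = 0 \<and> poly (qJ Q) x = 0 \<and> poly (qK Q) x = 0"
      by (intro sum_0) (simp add: qnorm_def)
    then have "qeval (of_real x) Q = 0"
      by (simp add: zero_quat_def quat.expand quat.map_sel ceval_of_real)
    with prim show False
      by (simp add: qprimitive_def)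
  qed
  with degree_P obtain l a1 b1 a2 b2 a3 b3
    where b: "b1 > 0" "b2 > 0" "b3 > 0" and a: "a1 \<le> a2" "a2 \<le> a3" and l: "l \<noteq> 0"
      and P: "P = smult l (quad a1 b1 * quad a2 b2 * quad a3 b3)"
    by (rule sextic_quad_factorization)
  \<comment> \<open>The value at 0 transfers the sign of \<open>P\<close> to
    \<open>l\<close>.\<close>
  have "poly P 0 = l * ((a1\<^sup>2 + b1\<^sup>2) * (a2\<^sup>2 + b2\<^sup>2) * (a3\<^sup>2 + b3\<^sup>2))"
    by (simp add: P quad_pCons)
  moreover have "(a1\<^sup>2 + b1\<^sup>2) * (a2\<^sup>2 + b2\<^sup>2) * (a3\<^sup>2 + b3\<^sup>2) > 0"
    using b by (intro mult_pos_pos add_nonneg_pos) simp_all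
  ultimately have "l > 0"
    using pos unfolding P_def by (metis zero_less_mult_pos2)
  \<comment> \<open>The degree bound 6 is spelled with successors because each splitting of a pair
    removes two.\<close>
  have deg_Q: "qdegree_le (Suc (Suc (Suc (Suc (Suc (Suc 0)))))) Q"
    using degree_dehom_le by (simp add: Q_def qpart_def qdegree_le_def eval_nat_numeral)
  have nz: "b1 \<noteq> 0" "b2 \<noteq> 0" "b3 \<noteq> 0"
    using b by simp_all
  have fact_Q: "qnorm Q = (quad a1 b1)\<^sup>2 * ((quad a2 b2)\<^sup>2 * ((quad a3 b3)\<^sup>2 * [:l\<^sup>2:]))"
    by (simp add: norm_Q P power2_eq_square mult_ac)
  obtain u1 v1 Q1
    where 1: "norm u1 = 1" "norm v1 = 1" "u1 \<noteq> - v1" "Q = lin a1 b1 u1 * lin a1 b1 v1 * Q1"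
      "qnorm Q1 = (quad a2 b2)\<^sup>2 * ((quad a3 b3)\<^sup>2 * [:l\<^sup>2:])" "qprimitive Q1"
      "qdegree_le (Suc (Suc (Suc (Suc 0)))) Q1"
    by (rule left_factor_twice[OF prim fact_Q nz(1) deg_Q])
  obtain u2 v2 Q2
    where 2: "norm u2 = 1" "norm v2 = 1" "u2 \<noteq> - v2" "Q1 = lin a2 b2 u2 * lin a2 b2 v2 * Q2"
      "qnorm Q2 = (quad a3 b3)\<^sup>2 * [:l\<^sup>2:]" "qprimitive Q2" "qdegree_le (Suc (Suc 0)) Q2"
    by (rule left_factor_twice[OF 1(6,5) nz(2) 1(7)])
  obtain u3 v3 Q3
    where 3: "norm u3 = 1" "norm v3 = 1" "u3 \<noteq> - v3" "Q2 = lin a3 b3 u3 * lin a3 b3 v3 * Q3"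
      "qnorm Q3 = [:l\<^sup>2:]" "qdegree_le 0 Q3"
    by (rule left_factor_twice[OF 2(6,5) nz(3) 2(7)])
  from qnorm_constant[OF 3(6,5)] obtain k where k: "Q3 = const_quat k" "norm k = \<bar>l\<bar>" .
  define d :: params
    where "d = ((vector [a1, a2, a3], vector [b1, b2, b3]), ((u1, v1), (u2, v2), (u3, v3)), k)"
  have "d \<in> param_dom closed_chamber"
    using a b 1 2 3 k \<open>l > 0\<close>
    by (auto simp: d_def param_dom_def closed_chamber_def nonantipodal_def forall_3)
  \<comment> \<open>Positivity of \<open>l\<close> gives \<open>norm k = l\<close>, so
    \<open>param_norm d\<close> is \<open>P\<close> itself and not its negative.\<close>
  moreover have "param_curve d = curve P Q"
    using k \<open>l > 0\<close> by (simp add: param_curve_def d_def P 1(4) 2(4) 3(4))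
  ultimately show ?thesis
    by (auto simp: P_def Q_def curve_qpart)
qed

section \<open>The space of curves as a continuous image\<close>

lemma proj_point_minus: "proj_point (- v) = proj_point v"
  unfolding proj_point_def span_eq
  using span_neg[of "- v" "{- v}"] by (simp add: span_base span_neg)

lemma dehom_minus: "dehom (- a) = - dehom a"
  by (rule poly_eqI) (simp add: coeff_dehom)

text \<open>Both \<open>c\<close> and \<open>- c\<close> represent the point, and
  \<open>p\<^sub>0\<close> does not vanish at 0, so \<open>ex_param\<close> applies to one of
  them.\<close>

lemma sextic_curves_S3_eq_image:
  "sextic_curves_S3 =
    proj_point ` param_curve ` {d \<in> param_dom closed_chamber. no_common_root (param_curve d)}"
proof (intro equalityI subsetI)
  fix x
  assume "x \<in> sextic_curves_S3"
  then obtain c where c: "x = proj_point c" "no_common_root c" "on_S3 c"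
    by (auto simp: sextic_curves_S3_def)
  have minus: "no_common_root (- c)" "on_S3 (- c)"
    using c by (simp_all add: no_common_root_iff on_S3_iff dehom_minus qpart_def qnorm_def)
  have "poly (dehom (c $ 0)) 0 \<noteq> 0"
  proof
    assume 0: "poly (dehom (c $ 0)) 0 = 0"
    then have "poly (qnorm (qpart c)) 0 = 0"
      using c by (simp add: on_S3_iff)
    then have "poly (dehom (c $ 1)) 0 = 0 \<and> poly (dehom (c $ 2)) 0 = 0 \<and>
        poly (dehom (c $ 3)) 0 = 0 \<and> poly (dehom (c $ 4)) 0 = 0"
      by (simp add: qnorm_def qpart_def) (smt (verit) zero_le_power2 power_eq_0_iff)
    with 0 have "\<forall>i. ceval (of_real 0) (dehom (c $ i)) = 0"
      unfolding ceval_of_real by (simp add: forall_5)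
    with c(2) show False
      unfolding no_common_root_iff by blast
  qed
  then consider "poly (dehom (c $ 0)) 0 > 0" | "poly (dehom ((- c) $ 0)) 0 > 0"
    by (fastforce simp: dehom_minus neq_iff)
  then show "x \<in> proj_point ` param_curve `
      {d \<in> param_dom closed_chamber. no_common_root (param_curve d)}"
  proof cases
    case 1
    with ex_param[of c] c show ?thesis
      by blast
  next
    case 2
    with ex_param[of "- c"] minus obtain d
      where "d \<in> param_dom closed_chamber" "param_curve d = - c"
      by blast
    moreover from this have "x = proj_point (param_curve d)"
      by (simp add: c proj_point_minus)
    moreover have "no_common_root (param_curve d)"
      using minus \<open>param_curve d = - c\<close> by simp
    ultimately show ?thesis
      by blast
  qed
next
  fix x
  assume "x \<in> proj_point ` param_curve ` {d \<in> param_dom closed_chamber. no_common_root (param_curve d)}"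
  then show "x \<in> sextic_curves_S3"
    using on_S3_param_curve by (auto simp: sextic_curves_S3_def)
qed

theorem theorem35:
  shows "connectedin projective_space sextic_curves_S3"
proof -
  define D where "D = {d \<in> param_dom closed_chamber. no_common_root (param_curve d)}"
  have "chamber \<subseteq> closed_chamber"
    by (auto simp: chamber_def closed_chamber_def)
  then have "param_dom chamber \<subseteq> D"
    using param_dom_mono no_common_root_param_curve by (auto simp: D_def)
  moreover have "D \<subseteq> closure (param_dom chamber)"
    using param_dom_subset_closure by (auto simp: D_def)
  ultimately have "connected D"
    by (rule connected_intermediate_closure[OF connected_param_dom])
  then have "connected (param_curve ` D)"
    by (intro connected_continuous_image continuous_on_param_curve)
  \<comment> \<open>The image has to avoid 0, since \<open>proj_point\<close> is the continuous
    quotient map only on the punctured space.\<close>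
  moreover have "param_curve ` D \<subseteq> - {0}"
    by (auto simp: D_def no_common_root_iff)
  ultimately have "connectedin (top_of_set (- {0})) (param_curve ` D)"
    by (simp add: connectedin_subtopology connectedin_iff_connected)
  then have "connectedin projective_space (proj_point ` param_curve ` D)"
    by (rule connectedin_continuous_map_image[OF
          quotient_imp_continuous_map[OF quotient_map_proj_point]])
  then show ?thesis
    by (simp add: sextic_curves_S3_eq_image D_def)
qed

end
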